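(* Let $n,d\ge 1$ be integers. A tensor $\mathcal{T}\in\mathbb{C}^{n^{2d}}$ is conjugate partial-symmetric (CPS) if and only if there exist a finite $m$, real numbers $\lambda_1,\dots,\lambda_m\in\mathbb{R}$ and vectors $\boldsymbol{a}_1,\dots,\boldsymbol{a}_m\in\mathbb{C}^n$ such that $$\mathcal{T}=\sum_{j=1}^m\lambda_j\,\overline{\boldsymbol{a}_j}^{\otimes d}\otimes\boldsymbol{a}_j^{\otimes d}.$$
   Context: $\mathbb{C}^{n^{2d}}$ denotes the space of complex tensors of order $2d$ with every mode of dimension $n$, with entries $\mathcal{T}_{i_1\dots i_{2d}}$, $1\le i_k\le n$. $\mathcal{T}\in\mathbb{C}^{n^{2d}}$ is partial-symmetric (PS) if its entries are invariant under any permutation of the first $d$ indices and under any permutation of the last $d$ indices. $\mathcal{T}$ is conjugate partial-symmetric (CPS) if it is PS and $\mathcal{T}_{i_1\dots i_d i_{d+1}\dots i_{2d}}=\overline{\mathcal{T}_{i_{d+1}\dots i_{2d}i_1\dots i_d}}$ for all indices. $\otimes$ is the outer product, $\boldsymbol{x}^{\otimes d}$ is the outer product of $d$ copies of $\boldsymbol{x}$, and $\overline{\boldsymbol{a}}$ is the entrywise complex conjugate. *)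

theory Defs
  imports "HOL-Analysis.Analysis" "HOL-Combinatorics.Permutations"
begin

text \<open>
  An order-\<open>k\<close> tensor all of whose modes have dimension \<open>CARD('n)\<close> is encoded by its entries,
  as a function on index tuples. Tuples are lists over \<open>'n\<close>; the entries at lists whose length
  is not the order are required to be \<open>0\<close>, so that equality of functions is equality of tensors.
\<close>

type_synonym 'n tensor = "'n list \<Rightarrow> complex"

definition tensors :: "nat \<Rightarrow> 'n tensor set" where
  "tensors k = {T. \<forall>i. length i \<noteq> k \<longrightarrow> T i = 0}"

definition partial_symmetric :: "nat \<Rightarrow> 'n tensor \<Rightarrow> bool" where
  "partial_symmetric d T \<longleftrightarrow>
     (\<forall>xs ys \<sigma>. length xs = d \<and> length ys = d \<and> \<sigma> permutes {..<d} \<longrightarrow>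
        T (permute_list \<sigma> xs @ ys) = T (xs @ ys) \<and>
        T (xs @ permute_list \<sigma> ys) = T (xs @ ys))"

definition conj_partial_symmetric :: "nat \<Rightarrow> 'n tensor \<Rightarrow> bool" where
  "conj_partial_symmetric d T \<longleftrightarrow>
     partial_symmetric d T \<and>
     (\<forall>xs ys. length xs = d \<and> length ys = d \<longrightarrow> T (xs @ ys) = cnj (T (ys @ xs)))"

text \<open>The parameter \<open>p\<close> is the order of the left factor.\<close>

definition outer :: "nat \<Rightarrow> 'n tensor \<Rightarrow> 'n tensor \<Rightarrow> 'n tensor" where
  "outer p S T = (\<lambda>i. S (take p i) * T (drop p i))"

definition tensor_of_vec :: "complex ^ 'n \<Rightarrow> 'n tensor" where
  "tensor_of_vec x = (\<lambda>i. if length i = 1 then x $ hd i else 0)"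

primrec tensor_power :: "complex ^ 'n \<Rightarrow> nat \<Rightarrow> 'n tensor" where
  "tensor_power x 0 = (\<lambda>i. if i = [] then 1 else 0)"
| "tensor_power x (Suc d) = outer 1 (tensor_of_vec x) (tensor_power x d)"

definition cnj_vec :: "complex ^ 'n \<Rightarrow> complex ^ 'n" where
  "cnj_vec x = (\<chi> k. cnj (x $ k))"

lemma outer_in_tensors:
  assumes "S \<in> tensors p" "T \<in> tensors q"
  shows "outer p S T \<in> tensors (p + q)"
proof -
  have "S (take p i) * T (drop p i) = 0" if "length i \<noteq> p + q" for i
  proof (cases "length i < p")
    case True
    then show ?thesis using assms(1) by (simp add: tensors_def)
  next
    case False
    then have "length (drop p i) \<noteq> q" using that by simp
    then have "T (drop p i) = 0" using assms(2) unfolding tensors_def by blast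
    then show ?thesis by simp
  qed
  then show ?thesis by (simp add: tensors_def outer_def)
qed

lemma outer_append: "length xs = p \<Longrightarrow> outer p S T (xs @ ys) = S xs * T ys"
  by (simp add: outer_def)

lemma tensor_power_eq:
  "tensor_power x d i = (if length i = d then (\<Prod>k<d. x $ (i ! k)) else 0)"
proof (induction d arbitrary: i)
  case 0
  then show ?case by simp
next
  case (Suc d)
  show ?case
  proof (cases i)
    case Nil
    then show ?thesis by (simp add: outer_def tensor_of_vec_def)
  next
    case (Cons y ys)
    then show ?thesis
      using Suc by (simp add: outer_def tensor_of_vec_def prod.lessThan_Suc_shift del: prod.lessThan_Suc)
  qed
qed

lemma tensor_power_in_tensors: "tensor_power x d \<in> tensors d"
  by (simp add: tensors_def tensor_power_eq)

end

theory Submission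
  imports Defs
begin

text \<open>
  The entries of \<open>cnj a\<^sup>d \<otimes> a\<^sup>d\<close> are multiplicative in \<open>a\<close>, so the complex span of these
  tensors is an algebra of functions on index tuples under entrywise multiplication. It separates
  any two index tuples that are not related by permuting the first \<open>d\<close> and the last \<open>d\<close> indices, and
  so by Lagrange interpolation it contains every partial-symmetric tensor. Since the rank-one
  tensors themselves are conjugate-symmetric, averaging a complex decomposition of a CPS tensor
  with its conjugate transpose replaces the coefficients by their real parts.
\<close>

section \<open>Interpolation in an algebra of functions on a finite set\<close>

text \<open>A finite Stone-Weierstrass theorem over any field. Points are added one at a time:
  either \<open>A\<close> cannot tell the new point from an old one, and the old interpolant is
  already right there, or a Lagrange basis function corrects its value.\<close>

lemma subalgebra_interpolation:
  fixes A :: "('i \<Rightarrow> 'k::field) set"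
  assumes const: "\<And>c. (\<lambda>_. c) \<in> A"
    and add: "\<And>F G. F \<in> A \<Longrightarrow> G \<in> A \<Longrightarrow> (\<lambda>i. F i + G i) \<in> A"
    and mult: "\<And>F G. F \<in> A \<Longrightarrow> G \<in> A \<Longrightarrow> (\<lambda>i. F i * G i) \<in> A"
    and "finite X"
    and "\<And>x y. x \<in> X \<Longrightarrow> y \<in> X \<Longrightarrow> (\<And>G. G \<in> A \<Longrightarrow> G x = G y) \<Longrightarrow> T x = T y"
  shows "\<exists>G\<in>A. \<forall>x\<in>X. G x = T x"
  using assms(4,5)
proof (induction X rule: finite_induct)
  case empty
  then show ?case using const by blast
next
  case (insert x X)
  then obtain G where G: "G \<in> A" "\<forall>y\<in>X. G y = T y" by (metis insertCI)
  show ?case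
  proof (cases "\<exists>y\<in>X. \<forall>G\<in>A. G x = G y")
    case True
    \<comment> \<open>For an unseparated \<open>y\<close> in \<open>X\<close>:
      \<open>G x = G y = T y = T x\<close>, the last by the hypothesis on \<open>T\<close>.\<close>
    then have "G x = T x" using G insert.prems by (metis insertCI)
    then show ?thesis using G by blast
  next
    case False
    have "\<exists>D\<in>A. D x = 1 \<and> (\<forall>y\<in>X. D y = 0)"
      using insert.hyps(1) False
    proof (induction X rule: finite_induct)
      case empty
      then show ?case using const[of 1] by auto
    next
      case (insert y X)
      then obtain D where D: "D \<in> A" "D x = 1" "\<forall>y\<in>X. D y = 0" by auto
      obtain H where H: "H \<in> A" "H x \<noteq> H y" using insert.prems by blast
      \<comment> \<open>The new Lagrange factor is affine in the separating function
        \<open>H\<close>, with value 1 at \<open>x\<close> and 0 at \<open>y\<close>; the zeros of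
        \<open>D\<close> persist.\<close>
      let ?E = "\<lambda>i. D i * ((H i + - H y) * inverse (H x - H y))"
      have "?E \<in> A" by (intro mult add const D H)
      moreover have "?E x = 1" using D H by simp
      moreover have "\<forall>z\<in>insert y X. ?E z = 0" using D by simp
      ultimately show ?case by (intro bexI[of _ ?E] conjI)
    qed
    then obtain D where D: "D \<in> A" "D x = 1" "\<forall>y\<in>X. D y = 0" by blast
    let ?F = "\<lambda>i. G i + (T x - G x) * D i"
    have "?F \<in> A" by (intro mult add const D G)
    moreover have "\<forall>y\<in>insert x X. ?F y = T y" using D G by simp
    ultimately show ?thesis by (intro bexI[of _ ?F])
  qed
qed

section \<open>Entries of the rank-one tensors\<close>

text \<open>The entry of the rank-one tensor of \<open>a\<close>, without the cut-off at length
  \<open>2 * d\<close>: this way the all-ones vector yields the constant 1 on every list.\<close>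

definition mixed_monomial :: "nat \<Rightarrow> complex ^ 'n \<Rightarrow> 'n tensor" where
  "mixed_monomial d a i = (\<Prod>k\<leftarrow>take d i. cnj (a $ k)) * (\<Prod>k\<leftarrow>drop d i. a $ k)"

lemma prod_list_map_conv_nth: "(\<Prod>k\<leftarrow>xs. f k) = (\<Prod>j<length xs. f (xs ! j))"
  by (simp add: prod.list_conv_set_nth atLeast0LessThan)

lemma outer_tensor_power_cnj:
  fixes a :: "complex ^ 'n::finite"
  shows "outer d (tensor_power (cnj_vec a) d) (tensor_power a d) i =
    (if length i = 2 * d then mixed_monomial d a i else 0)"
proof (cases "length i = 2 * d")
  case True
  then show ?thesis
    by (simp add: outer_def tensor_power_eq mixed_monomial_def prod_list_map_conv_nth cnj_vec_def)
next
  case False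
  then show ?thesis by (auto simp: outer_def tensor_power_eq)
qed

lemma prod_list_map_mult:
  "(\<Prod>k\<leftarrow>xs. f k * g k) = (\<Prod>k\<leftarrow>xs. f k) * (\<Prod>k\<leftarrow>xs. g k :: 'a::comm_monoid_mult)"
  by (induction xs) (simp_all add: ac_simps)

lemma mixed_monomial_mult:
  fixes a b :: "complex ^ 'n::finite"
  shows "mixed_monomial d a i * mixed_monomial d b i = mixed_monomial d (\<chi> k. a $ k * b $ k) i"
  by (simp add: mixed_monomial_def prod_list_map_mult ac_simps)

lemma mixed_monomial_one:
  "mixed_monomial d (\<chi> k. 1) i = 1"
  by (simp add: mixed_monomial_def map_replicate_const)

lemma mixed_monomial_append:
  "length xs = d \<Longrightarrow>
    mixed_monomial d a (xs @ ys) = (\<Prod>k\<leftarrow>xs. cnj (a $ k)) * (\<Prod>k\<leftarrow>ys. a $ k)"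
  by (simp add: mixed_monomial_def)

lemma prod_list_mset_cong:
  fixes f :: "'b \<Rightarrow> 'a::comm_monoid_mult"
  assumes "mset xs = mset ys"
  shows "(\<Prod>k\<leftarrow>xs. f k) = (\<Prod>k\<leftarrow>ys. f k)"
  using assms by (metis mset_map prod_mset_prod_list)

lemma mixed_monomial_permute:
  assumes "length xs = d" "length xs' = d" "mset xs = mset xs'" "mset ys = mset ys'"
  shows "mixed_monomial d a (xs @ ys) = mixed_monomial d a (xs' @ ys')"
  using assms(1,2) prod_list_mset_cong[OF assms(3), of "\<lambda>k. cnj (a $ k)"]
    prod_list_mset_cong[OF assms(4), of "($) a"]
  by (simp add: mixed_monomial_append)

text \<open>Conjugation exchanges the conjugated and the plain factors, and swapping the two halves
  of the index undoes this.\<close>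

lemma cnj_mixed_monomial_swap:
  assumes "length xs = d" "length ys = d"
  shows "cnj (mixed_monomial d a (ys @ xs)) = mixed_monomial d a (xs @ ys)"
proof -
  have "cnj (\<Prod>k\<leftarrow>zs. f k) = (\<Prod>k\<leftarrow>zs. cnj (f k))" for f :: "'a \<Rightarrow> complex" and zs
    by (induction zs) simp_all
  then show ?thesis using assms by (simp add: mixed_monomial_append)
qed

section \<open>The algebra spanned by the monomials\<close>

text \<open>The complex linear span. Scalars sit in the generators, so closure under sums is the
  only other rule.\<close>

inductive_set mixed_span :: "nat \<Rightarrow> 'n::finite tensor set" for d where
  scale: "(\<lambda>i. c * mixed_monomial d a i) \<in> mixed_span d"
| add: "F \<in> mixed_span d \<Longrightarrow> G \<in> mixed_span d \<Longrightarrow> (\<lambda>i. F i + G i) \<in> mixed_span d"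

lemma mixed_monomial_in_span: "mixed_monomial d a \<in> mixed_span d"
  using mixed_span.scale[of 1 d a] by simp

lemma mixed_span_const: "(\<lambda>_. c) \<in> mixed_span d"
  using mixed_span.scale[of c d "\<chi> k. 1"] by (simp add: mixed_monomial_one)

text \<open>By distributivity in each factor it suffices to multiply two generators, and their
  product is the generator of the entrywise product of the vectors.\<close>

lemma mixed_span_mult:
  assumes "F \<in> mixed_span d" "G \<in> mixed_span d"
  shows "(\<lambda>i. F i * G i) \<in> mixed_span d"
  using assms(1)
proof (induction rule: mixed_span.induct)
  case (scale c a)
  from assms(2) show ?case
  proof (induction rule: mixed_span.induct)
    case (scale c' a')
    have "(\<lambda>i. c * mixed_monomial d a i * (c' * mixed_monomial d a' i)) =
      (\<lambda>i. c * c' * mixed_monomial d (\<chi> k. a $ k * a' $ k) i)"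
      by (simp add: mixed_monomial_mult[symmetric] ac_simps)
    then show ?case using mixed_span.scale by simp
  next
    case (add F G)
    then show ?case by (simp add: distrib_left mixed_span.add)
  qed
next
  case (add F G)
  then show ?case by (simp add: distrib_right mixed_span.add)
qed

lemma mixed_span_finite_sum:
  assumes "F \<in> mixed_span d"
  shows "\<exists>m c a. \<forall>i. F i = (\<Sum>j=1..m::nat. c j * mixed_monomial d (a j) i)"
  using assms
proof (induction rule: mixed_span.induct)
  case (scale c a)
  show ?case by (rule exI[of _ 1], rule exI[of _ "\<lambda>_. c"], rule exI[of _ "\<lambda>_. a"]) simp
next
  case (add F G)
  from add.IH obtain m c a m' c' a' where
    F: "\<And>i. F i = (\<Sum>j=1..m::nat. c j * mixed_monomial d (a j) i)" and
    G: "\<And>i. G i = (\<Sum>j=1..m'::nat. c' j * mixed_monomial d (a' j) i)" by blast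
  \<comment> \<open>The two families are concatenated: indices above \<open>m\<close> address the
    second one, shifted by \<open>m\<close>.\<close>
  let ?c = "\<lambda>j. if j \<le> m then c j else c' (j - m)"
  let ?a = "\<lambda>j. if j \<le> m then a j else a' (j - m)"
  have "F i + G i = (\<Sum>j=1..m + m'. ?c j * mixed_monomial d (?a j) i)" for i
  proof -
    have "(\<Sum>j=1..m + m'. ?c j * mixed_monomial d (?a j) i) =
      (\<Sum>j=1..m. ?c j * mixed_monomial d (?a j) i) +
      (\<Sum>j=m + 1..m + m'. ?c j * mixed_monomial d (?a j) i)"
      by (rule sum.ub_add_nat) simp
    also have "(\<Sum>j=m + 1..m + m'. ?c j * mixed_monomial d (?a j) i) =
      (\<Sum>j=1..m'. ?c (j + m) * mixed_monomial d (?a (j + m)) i)"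
      using sum.shift_bounds_cl_nat_ivl[of "\<lambda>j. ?c j * mixed_monomial d (?a j) i" 1 m m']
      by (simp add: add.commute)
    finally show ?thesis by (simp add: F G)
  qed
  then show ?case
    by (intro exI[of _ "m + m'"] exI[of _ ?c] exI[of _ ?a] allI)
qed

section \<open>Separation of index tuples\<close>

text \<open>The real value \<open>z = 2\<close> determines the total degree. With equal totals, a
  suitable point of the unit circle distinguishes the splittings.\<close>

lemma cnj_power_mult_power_inject:
  fixes p q p' q' :: nat
  assumes eq: "\<And>z. cnj z ^ p * z ^ q = cnj z ^ p' * z ^ q'"
  shows "p = p' \<and> q = q'"
proof -
  have "(2::complex) ^ (p + q) = 2 ^ (p' + q')" using eq[of 2] by (simp add: power_add)
  then have "(2::real) ^ (p + q) = 2 ^ (p' + q')"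
    by (metis Re_complex_of_real of_real_numeral of_real_power)
  then have sum: "p + q = p' + q'" by simp
  have False if less: "p < p'" and sum: "p + q = p' + q'"
    and eq: "\<And>z. cnj z ^ p * z ^ q = cnj z ^ p' * z ^ q'" for p q p' q' :: nat
  proof -
    obtain m where m: "p' = p + m" "q = q' + m" "m > 0"
      using less sum by (intro that[of "p' - p"]) auto
    \<comment> \<open>Cancelling common factors in \<open>eq\<close> leaves
      \<open>z ^ m = cnj z ^ m\<close> for nonzero \<open>z\<close>. This root of unity has
      \<open>m\<close>-th power \<open>\<i>\<close>, which is not its own conjugate.\<close>
    let ?z = "cis (pi / (2 * m))"
    have "?z ^ m = cis (m * (pi / (2 * m)))" by (rule Complex.DeMoivre)
    also have "m * (pi / (2 * m)) = pi / 2" using m(3) by simp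
    finally have "?z ^ m = \<i>" by simp
    moreover from this have "cnj ?z ^ m = - \<i>" by (metis complex_cnj_i complex_cnj_power)
    moreover have "?z ^ m = cnj ?z ^ m"
      using eq[of ?z] by (simp add: m power_add ac_simps)
    ultimately show False by simp
  qed
  from this[of p p' q q'] this[of p' p q' q] show ?thesis using sum eq by force
qed

lemma prod_list_delta:
  "(\<Prod>j\<leftarrow>xs. if j = k then z else 1) = (z :: 'a::comm_monoid_mult) ^ count (mset xs) k"
  by (induction xs) auto

text \<open>Setting every coordinate of \<open>a\<close> to 1 except the one at \<open>k\<close>
  leaves powers of \<open>cnj z\<close> and \<open>z\<close> whose exponents count the occurrences
  of \<open>k\<close> in each half.\<close>

lemma mixed_monomial_separates:
  fixes xs ys xs' ys' :: "'n::finite list"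
  assumes len: "length xs = d" "length xs' = d"
    and eq: "\<And>a. mixed_monomial d a (xs @ ys) = mixed_monomial d a (xs' @ ys')"
  shows "mset xs = mset xs' \<and> mset ys = mset ys'"
proof -
  have "count (mset xs) k = count (mset xs') k \<and> count (mset ys) k = count (mset ys') k" for k
  proof (rule cnj_power_mult_power_inject)
    fix z :: complex
    have cnj_if: "cnj (if j = k then z else 1) = (if j = k then cnj z else 1)" for j by simp
    show "cnj z ^ count (mset xs) k * z ^ count (mset ys) k =
      cnj z ^ count (mset xs') k * z ^ count (mset ys') k"
      using eq[of "\<chi> j. if j = k then z else 1"] len
      by (simp add: mixed_monomial_append cnj_if prod_list_delta)
  qed
  then show ?thesis by (simp add: multiset_eq_iff)
qed

section \<open>Decomposition of partial-symmetric tensors\<close>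

lemma partial_symmetric_mset_cong:
  assumes "partial_symmetric d T"
    and "length xs = d" "length ys = d" "mset xs = mset xs'" "mset ys = mset ys'"
  shows "T (xs @ ys) = T (xs' @ ys')"
proof -
  have len: "length xs' = d" "length ys' = d" using assms by (metis size_mset)+
  obtain p where p: "p permutes {..<d}" "permute_list p xs' = xs"
    using mset_eq_permutation[OF assms(4)] len by metis
  obtain q where q: "q permutes {..<d}" "permute_list q ys' = ys"
    using mset_eq_permutation[OF assms(5)] len by metis
  have "T (xs @ ys) = T (xs' @ ys)"
    using assms(1,3) len p unfolding partial_symmetric_def by metis
  also have "\<dots> = T (xs' @ ys')"
    using assms(1) len q unfolding partial_symmetric_def by metis
  finally show ?thesis .
qed

lemma split_index:
  assumes "length i = 2 * d"
  obtains xs ys where "i = xs @ ys" "length xs = d" "length ys = d"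
  using assms that[of "take d i" "drop d i"] by simp

text \<open>Interpolation on the finitely many tuples of length \<open>2 * d\<close>: tuples that
  the span does not separate agree up to permutations within the halves, so \<open>T\<close> agrees
  on them too.\<close>

lemma partial_symmetric_in_mixed_span:
  fixes T :: "'n::finite tensor"
  assumes "partial_symmetric d T"
  shows "\<exists>F\<in>mixed_span d. \<forall>i. length i = 2 * d \<longrightarrow> F i = T i"
proof -
  let ?X = "{i :: 'n list. length i = 2 * d}"
  have "\<exists>F\<in>mixed_span d. \<forall>i\<in>?X. F i = T i"
  proof (rule subalgebra_interpolation)
    show "finite ?X" using finite_lists_length_eq[of "UNIV :: 'n set"] by simp
  next
    fix i i' :: "'n list"
    assume len: "i \<in> ?X" "i' \<in> ?X" and eq: "\<And>G. G \<in> mixed_span d \<Longrightarrow> G i = G i'"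
    obtain xs ys where i: "i = xs @ ys" "length xs = d" "length ys = d"
      using len(1) by (auto elim: split_index)
    obtain xs' ys' where i': "i' = xs' @ ys'" "length xs' = d" "length ys' = d"
      using len(2) by (auto elim: split_index)
    have "mixed_monomial d a (xs @ ys) = mixed_monomial d a (xs' @ ys')" for a
      using eq[OF mixed_monomial_in_span] i i' by simp
    then have "mset xs = mset xs' \<and> mset ys = mset ys'"
      using mixed_monomial_separates[OF i(2) i'(2)] by blast
    then show "T i = T i'"
      using partial_symmetric_mset_cong[OF assms i(2,3)] unfolding i(1) i'(1) by blast
  qed (rule mixed_span_const mixed_span.add mixed_span_mult; assumption)+
  then show ?thesis by simp
qed

lemma conj_partial_symmetric_decomposition:
  fixes T :: "'n::finite tensor"
  assumes "conj_partial_symmetric d T"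
  shows "\<exists>m (l :: nat \<Rightarrow> real) a. \<forall>i. length i = 2 * d \<longrightarrow>
    T i = (\<Sum>j=1..m. complex_of_real (l j) * mixed_monomial d (a j) i)"
proof -
  have "partial_symmetric d T" using assms by (simp add: conj_partial_symmetric_def)
  then obtain F where F: "F \<in> mixed_span d" "\<And>i. length i = 2 * d \<Longrightarrow> F i = T i"
    using partial_symmetric_in_mixed_span by blast
  obtain m c a where "\<And>i. F i = (\<Sum>j=1..m::nat. c j * mixed_monomial d (a j) i)"
    using mixed_span_finite_sum[OF F(1)] by blast
  with F(2) have T: "T i = (\<Sum>j=1..m. c j * mixed_monomial d (a j) i)" if "length i = 2 * d" for i
    using that by metis
  have "T i = (\<Sum>j=1..m. complex_of_real (Re (c j)) * mixed_monomial d (a j) i)"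
    if "length i = 2 * d" for i
  proof -
    obtain xs ys where i: "i = xs @ ys" "length xs = d" "length ys = d"
      using \<open>length i = 2 * d\<close> by (rule split_index)
    have "T i = cnj (T (ys @ xs))"
      using assms i unfolding conj_partial_symmetric_def by blast
    \<comment> \<open>Each monomial is fixed by the conjugate swap, so only the coefficients are
      conjugated; adding both expansions gives twice the real parts.\<close>
    also have "\<dots> = (\<Sum>j=1..m. cnj (c j) * mixed_monomial d (a j) i)"
      using i by (simp add: T cnj_mixed_monomial_swap)
    finally have "T i + T i = (\<Sum>j=1..m. (c j + cnj (c j)) * mixed_monomial d (a j) i)"
      using T[OF that] by (simp add: distrib_right sum.distrib)
    also have "\<dots> = 2 * (\<Sum>j=1..m. complex_of_real (Re (c j)) * mixed_monomial d (a j) i)"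
      by (simp add: complex_add_cnj sum_distrib_left mult.assoc)
    finally show ?thesis by simp
  qed
  then show ?thesis by (intro exI[of _ m] exI[of _ "\<lambda>j. Re (c j)"] exI[of _ a]) blast
qed

text \<open>Every monomial has both symmetries, and real coefficients survive conjugation.\<close>

lemma conj_partial_symmetric_sum:
  assumes "\<And>i. length i = 2 * d \<Longrightarrow>
    T i = (\<Sum>j=1..m::nat. complex_of_real (l j) * mixed_monomial d (a j) i)"
  shows "conj_partial_symmetric d T"
  unfolding conj_partial_symmetric_def partial_symmetric_def
proof (intro conjI allI impI; elim conjE)
  fix xs ys :: "'a list" and p :: "nat \<Rightarrow> nat"
  assume "length xs = d" "length ys = d" "p permutes {..<d}"
  then show "T (permute_list p xs @ ys) = T (xs @ ys)" "T (xs @ permute_list p ys) = T (xs @ ys)"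
    by (auto simp: assms intro!: sum.cong mixed_monomial_permute)
next
  fix xs ys :: "'a list"
  assume "length xs = d" "length ys = d"
  then show "T (xs @ ys) = cnj (T (ys @ xs))"
    by (simp add: assms cnj_mixed_monomial_swap)
qed

theorem theorem3p2:
  fixes T :: "'n::finite tensor" and d :: nat
  assumes "d \<ge> 1" and "T \<in> tensors (2 * d)"
  shows "conj_partial_symmetric d T \<longleftrightarrow>
    (\<exists>(m::nat) (l :: nat \<Rightarrow> real) (a :: nat \<Rightarrow> complex ^ 'n).
       T = (\<lambda>i. \<Sum>j=1..m. complex_of_real (l j) *
                   outer d (tensor_power (cnj_vec (a j)) d) (tensor_power (a j) d) i))"
proof
  assume "conj_partial_symmetric d T"
  then obtain m and l :: "nat \<Rightarrow> real" and a where
    "\<And>i. length i = 2 * d \<Longrightarrow> T i = (\<Sum>j=1..m. complex_of_real (l j) * mixed_monomial d (a j) i)"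
    using conj_partial_symmetric_decomposition by blast
  \<comment> \<open>At other lengths the rank-one tensors vanish as well, so the decomposition
    extends to an equality of functions on all lists.\<close>
  moreover have "T i = 0" if "length i \<noteq> 2 * d" for i
    using that assms(2) by (simp add: tensors_def)
  ultimately have "T i = (\<Sum>j=1..m. complex_of_real (l j) *
      outer d (tensor_power (cnj_vec (a j)) d) (tensor_power (a j) d) i)" for i
    by (cases "length i = 2 * d") (simp_all add: outer_tensor_power_cnj)
  then have "T = (\<lambda>i. \<Sum>j=1..m. complex_of_real (l j) *
      outer d (tensor_power (cnj_vec (a j)) d) (tensor_power (a j) d) i)" by blast
  then show "\<exists>(m::nat) (l :: nat \<Rightarrow> real) (a :: nat \<Rightarrow> complex ^ 'n).
       T = (\<lambda>i. \<Sum>j=1..m. complex_of_real (l j) *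
                   outer d (tensor_power (cnj_vec (a j)) d) (tensor_power (a j) d) i)"
    by blast
next
  assume "\<exists>(m::nat) (l :: nat \<Rightarrow> real) (a :: nat \<Rightarrow> complex ^ 'n).
       T = (\<lambda>i. \<Sum>j=1..m. complex_of_real (l j) *
                   outer d (tensor_power (cnj_vec (a j)) d) (tensor_power (a j) d) i)"
  then show "conj_partial_symmetric d T"
    by (auto simp: outer_tensor_power_cnj intro: conj_partial_symmetric_sum)
qed

end
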